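(* The variety $\mathbf{V}(\mathrm{Lang}(+,\cdot,\circ,0,1))$ generated by the class of language algebras of similarity type $(+,\cdot,\circ,0,1)$ is axiomatized by the equation $(x\circ y)\cdot 1=(x\cdot 1)\circ(y\cdot 1)$ together with the set of equations $\mathrm{Ax}^i(+,\cdot,\circ,0,1)$.
   Context: An algebra $\mathfrak{A}=(A,+,\cdot,\circ,0,1)$ is a language algebra if there is an alphabet $\Sigma$ with $A\subseteq\wp(\Sigma^* )$ ($\Sigma^*$ the set of finite words over $\Sigma$), where $+$ is union, $\cdot$ is intersection, $\circ$ is concatenation $a\circ b=\{st: s\in a, t\in b\}$, $0$ is the empty language and $1$ is the language consisting only of the empty word. $\mathrm{Lang}(+,\cdot,\circ,0,1)$ is the class of such algebras, and $\mathbf{V}(K)$ denotes the variety generated by a class $K$. Conventions: $x\le y$ abbreviates $x\cdot y=x$; $\circ$ binds tighter than $\cdot$ and $+$. $\mathrm{Ax}^i(+,\cdot,\circ,0,1)$ consists of: the distributive lattice axioms for $+$ and $\cdot$; the monoid axioms for $\circ$ and $1$; monotonicity $(x\cdot x')\circ(y\cdot y')\le x\circ y$; $0=0\cdot x$; $0=0\circ x=x\circ 0$; $(1\cdot x)\circ(1\cdot y)=1\cdot x\cdot y$; $(1\cdot x)\circ(y\cdot z)=((1\cdot x)\circ y)\cdot z$; $(x\cdot y)\circ(1\cdot z)=x\cdot (y\circ(1\cdot z))$; $1\cdot(x\circ y)=1\cdot(y\circ x)$; $(1\cdot x)\circ y=y\circ(1\cdot x)$; and additivity $(x+y)\circ z=x\circ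 z+y\circ z$, $x\circ(y+z)=x\circ y+x\circ z$. *)

theory Defs
  imports Main "HOL-Library.FuncSet"
begin

section \<open>Algebras of similarity type \<open>(+, \<cdot>, \<circ>, 0, 1)\<close>\<close>

record 'a alg =
  carrier :: "'a set"
  plus_op :: "'a \<Rightarrow> 'a \<Rightarrow> 'a"
  times_op :: "'a \<Rightarrow> 'a \<Rightarrow> 'a"
  comp_op :: "'a \<Rightarrow> 'a \<Rightarrow> 'a"
  zero_el :: 'a
  one_el :: 'a

text \<open>Operations are total functions on the type, but only their values on the carrier matter.\<close>

definition algebra :: "'a alg \<Rightarrow> bool" where
  "algebra A \<longleftrightarrow>
     zero_el A \<in> carrier A \<and> one_el A \<in> carrier A \<and>
     (\<forall>a\<in>carrier A. \<forall>b\<in>carrier A.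
        plus_op A a b \<in> carrier A \<and> times_op A a b \<in> carrier A \<and> comp_op A a b \<in> carrier A)"

section \<open>Language algebras\<close>

definition lang_conc :: "'c list set \<Rightarrow> 'c list set \<Rightarrow> 'c list set" where
  "lang_conc a b = {s @ t | s t. s \<in> a \<and> t \<in> b}"

definition language_algebra :: "'c list set alg \<Rightarrow> bool" where
  "language_algebra A \<longleftrightarrow> algebra A \<and>
     (\<exists>\<Sigma> :: 'c set. carrier A \<subseteq> Pow (lists \<Sigma>)) \<and>
     (\<forall>a\<in>carrier A. \<forall>b\<in>carrier A.
        plus_op A a b = a \<union> b \<and> times_op A a b = a \<inter> b \<and> comp_op A a b = lang_conc a b) \<and>
     zero_el A = {} \<and> one_el A = {[]}"

definition Lang :: "'c list set alg set" where
  "Lang = {A. language_algebra A}"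

section \<open>Terms, equations and models\<close>

datatype 'v trm =
    Var 'v
  | Zero ("\<zero>")
  | One ("\<one>")
  | Plus "'v trm" "'v trm" (infixl "\<oplus>" 65)
  | Times "'v trm" "'v trm" (infixl "\<odot>" 70)
  | Comp "'v trm" "'v trm" (infixl "\<otimes>" 75)

primrec eval :: "'a alg \<Rightarrow> ('v \<Rightarrow> 'a) \<Rightarrow> 'v trm \<Rightarrow> 'a" where
  "eval A v (Var x) = v x"
| "eval A v \<zero> = zero_el A"
| "eval A v \<one> = one_el A"
| "eval A v (s \<oplus> t) = plus_op A (eval A v s) (eval A v t)"
| "eval A v (s \<odot> t) = times_op A (eval A v s) (eval A v t)"
| "eval A v (s \<otimes> t) = comp_op A (eval A v s) (eval A v t)"

type_synonym equation = "nat trm \<times> nat trm"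

abbreviation equ :: "nat trm \<Rightarrow> nat trm \<Rightarrow> equation" (infix "\<doteq>" 50) where
  "s \<doteq> t \<equiv> (s, t)"

abbreviation leq :: "nat trm \<Rightarrow> nat trm \<Rightarrow> equation" (infix "\<preceq>" 50) where
  "s \<preceq> t \<equiv> s \<odot> t \<doteq> s"

definition satisfies :: "'a alg \<Rightarrow> equation \<Rightarrow> bool" where
  "satisfies A e \<longleftrightarrow>
     (\<forall>v. (\<forall>x. v x \<in> carrier A) \<longrightarrow> eval A v (fst e) = eval A v (snd e))"

definition models :: "equation set \<Rightarrow> 'a alg set" where
  "models E = {A. algebra A \<and> (\<forall>e\<in>E. satisfies A e)}"

section \<open>The axioms\<close>

abbreviation "X \<equiv> Var (0::nat)"
abbreviation "Y \<equiv> Var (1::nat)"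
abbreviation "Z \<equiv> Var (2::nat)"
abbreviation "X' \<equiv> Var (3::nat)"
abbreviation "Y' \<equiv> Var (4::nat)"

definition distributive_lattice_axioms :: "equation set" where
  "distributive_lattice_axioms =
    {(X \<oplus> Y) \<oplus> Z \<doteq> X \<oplus> (Y \<oplus> Z),
     (X \<odot> Y) \<odot> Z \<doteq> X \<odot> (Y \<odot> Z),
     X \<oplus> Y \<doteq> Y \<oplus> X,
     X \<odot> Y \<doteq> Y \<odot> X,
     X \<oplus> X \<doteq> X,
     X \<odot> X \<doteq> X,
     X \<oplus> X \<odot> Y \<doteq> X,
     X \<odot> (X \<oplus> Y) \<doteq> X,
     X \<odot> (Y \<oplus> Z) \<doteq> X \<odot> Y \<oplus> X \<odot> Z,
     X \<oplus> Y \<odot> Z \<doteq> (X \<oplus> Y) \<odot> (X \<oplus> Z)}"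

definition monoid_axioms :: "equation set" where
  "monoid_axioms =
    {(X \<otimes> Y) \<otimes> Z \<doteq> X \<otimes> (Y \<otimes> Z),
     \<one> \<otimes> X \<doteq> X,
     X \<otimes> \<one> \<doteq> X}"

definition Ax\<^sub>i :: "equation set" where
  "Ax\<^sub>i = distributive_lattice_axioms \<union> monoid_axioms \<union>
    {(X \<odot> X') \<otimes> (Y \<odot> Y') \<preceq> X \<otimes> Y,
     \<zero> \<doteq> \<zero> \<odot> X,
     \<zero> \<doteq> \<zero> \<otimes> X,
     \<zero> \<otimes> X \<doteq> X \<otimes> \<zero>,
     (\<one> \<odot> X) \<otimes> (\<one> \<odot> Y) \<doteq> \<one> \<odot> X \<odot> Y,
     (\<one> \<odot> X) \<otimes> (Y \<odot> Z) \<doteq> ((\<one> \<odot> X) \<otimes> Y) \<odot> Z,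
     (X \<odot> Y) \<otimes> (\<one> \<odot> Z) \<doteq> X \<odot> (Y \<otimes> (\<one> \<odot> Z)),
     \<one> \<odot> (X \<otimes> Y) \<doteq> \<one> \<odot> (Y \<otimes> X),
     (\<one> \<odot> X) \<otimes> Y \<doteq> Y \<otimes> (\<one> \<odot> X),
     (X \<oplus> Y) \<otimes> Z \<doteq> X \<otimes> Z \<oplus> Y \<otimes> Z,
     X \<otimes> (Y \<oplus> Z) \<doteq> X \<otimes> Y \<oplus> X \<otimes> Z}"

section \<open>The variety generated by a class\<close>

definition subalgebra :: "'a alg \<Rightarrow> 'a alg \<Rightarrow> bool" where
  "subalgebra B A \<longleftrightarrow> algebra B \<and> carrier B \<subseteq> carrier A \<and>
     zero_el B = zero_el A \<and> one_el B = one_el A \<and>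
     (\<forall>a\<in>carrier B. \<forall>b\<in>carrier B.
        plus_op B a b = plus_op A a b \<and> times_op B a b = times_op A a b \<and>
        comp_op B a b = comp_op A a b)"

definition homomorphism :: "('b \<Rightarrow> 'a) \<Rightarrow> 'b alg \<Rightarrow> 'a alg \<Rightarrow> bool" where
  "homomorphism h B A \<longleftrightarrow> h ` carrier B \<subseteq> carrier A \<and>
     h (zero_el B) = zero_el A \<and> h (one_el B) = one_el A \<and>
     (\<forall>a\<in>carrier B. \<forall>b\<in>carrier B.
        h (plus_op B a b) = plus_op A (h a) (h b) \<and>
        h (times_op B a b) = times_op A (h a) (h b) \<and>
        h (comp_op B a b) = comp_op A (h a) (h b))"

definition product_alg :: "'i set \<Rightarrow> ('i \<Rightarrow> 'a alg) \<Rightarrow> ('i \<Rightarrow> 'a) alg" where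
  "product_alg I F =
    \<lparr>carrier = (\<Pi>\<^sub>E i\<in>I. carrier (F i)),
     plus_op = (\<lambda>f g. \<lambda>i\<in>I. plus_op (F i) (f i) (g i)),
     times_op = (\<lambda>f g. \<lambda>i\<in>I. times_op (F i) (f i) (g i)),
     comp_op = (\<lambda>f g. \<lambda>i\<in>I. comp_op (F i) (f i) (g i)),
     zero_el = (\<lambda>i\<in>I. zero_el (F i)),
     one_el = (\<lambda>i\<in>I. one_el (F i))\<rparr>"

definition \<H> :: "'b alg set \<Rightarrow> 'a alg set" where
  "\<H> K = {A. algebra A \<and> (\<exists>B\<in>K. \<exists>h. homomorphism h B A \<and> h ` carrier B = carrier A)}"

definition \<S> :: "'a alg set \<Rightarrow> 'a alg set" where
  "\<S> K = {B. \<exists>A\<in>K. subalgebra B A}"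

definition \<P> :: "'a alg set \<Rightarrow> ('i \<Rightarrow> 'a) alg set" where
  "\<P> K = {product_alg I F | I F. \<forall>i\<in>I. F i \<in> K}"

text \<open>
  The generated variety is \<open>HSP K\<close>. HOL cannot quantify over the index sets of products across
  all types, so the type \<open>'i\<close> of indices is a parameter; index sets are arbitrary subsets of it.
  An algebra \<open>A\<close> of the generated variety is a quotient of the free algebra over \<open>carrier A\<close>, and
  this is a subdirect product of subalgebras of members of \<open>K\<close> indexed by pairs of terms over
  \<open>carrier A\<close>. Hence any infinite \<open>'i\<close> that is at least as large as \<open>'a\<close> yields all
  members of the generated variety on the type \<open>'a\<close>. Similarly, the letters of \<open>Lang\<close> are taken
  from a type \<open>'c\<close>, whose subsets are the alphabets; an infinite \<open>'c\<close> represents all alphabets,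
  because an equation failing in a language algebra fails in one over a finite alphabet.
\<close>

definition generated_variety :: "'i itself \<Rightarrow> 'b alg set \<Rightarrow> 'a alg set" where
  "generated_variety _ K = \<H> (\<S> (\<P> K :: ('i \<Rightarrow> 'b) alg set))"

end

theory Submission
  imports Defs
begin

text \<open>
  Soundness is routine. For completeness, the axioms reduce every term to a finite sum of terms
  \<open>e\<close> or \<open>e \<circ> p\<close>, where \<open>e = 1 \<cdot> x\<^sub>1 \<cdot> \<dots> \<cdot> x\<^sub>n\<close> records which variables contain the empty word and \<open>p\<close> is
  built from variables by \<open>\<cdot>\<close> and \<open>\<circ>\<close> only. Given a model \<open>A\<close> of the axioms and such an \<open>e \<circ> p\<close>, read \<open>p\<close>
  as a series-parallel graph, arrange its nodes injectively on a line and label the steps of the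
  line by distinct letters; factors of the resulting word are then intervals of nodes, and each
  interval carries a filter of elements of \<open>A\<close>. The induced languages satisfy: if the whole word
  belongs to a term \<open>t\<close>, then \<open>e \<circ> p \<le> t\<close> in \<open>A\<close>. Hence every equation valid in all language algebras
  holds in \<open>A\<close>, and \<open>A\<close> is a quotient of a subalgebra of a power of the full language algebra whose
  factors separate pairs of terms over \<open>A\<close>.
\<close>

section \<open>Soundness\<close>

lemma eval_closed:
  assumes "algebra A" "\<And>x. v x \<in> carrier A"
  shows "eval A v t \<in> carrier A"
  by (induction t) (use assms in \<open>auto simp: algebra_def\<close>)

lemma algebra_product:
  assumes "\<And>i. i \<in> I \<Longrightarrow> algebra (F i)"
  shows "algebra (product_alg I F)"
  using assms by (auto simp: algebra_def product_alg_def PiE_iff)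

lemma eval_product:
  assumes "i \<in> I"
  shows "eval (product_alg I F) v t i = eval (F i) (\<lambda>x. v x i) t"
  by (induction t) (use assms in \<open>auto simp: product_alg_def\<close>)

lemma product_satisfies:
  assumes "\<And>i. i \<in> I \<Longrightarrow> algebra (F i)" "\<And>i. i \<in> I \<Longrightarrow> satisfies (F i) e"
  shows "satisfies (product_alg I F) e"
  unfolding satisfies_def
proof (intro allI impI)
  fix v :: "nat \<Rightarrow> _" assume v: "\<forall>x. v x \<in> carrier (product_alg I F)"
  have mem: "eval (product_alg I F) v t \<in> (\<Pi>\<^sub>E i\<in>I. carrier (F i))" for t
    using eval_closed[OF algebra_product[of I F], of v t] assms(1) v
    by (auto simp: product_alg_def)
  show "eval (product_alg I F) v (fst e) = eval (product_alg I F) v (snd e)"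
  \<comment> \<open>Both values are extensional functions on \<open>I\<close>, so agreement at each
    index in \<open>I\<close> suffices.\<close>
  proof (rule PiE_ext[OF mem mem])
    fix i assume i: "i \<in> I"
    then have "\<forall>x. v x i \<in> carrier (F i)" using v by (auto simp: product_alg_def PiE_iff)
    then show "eval (product_alg I F) v (fst e) i = eval (product_alg I F) v (snd e) i"
      using assms(2)[OF i] by (auto simp: eval_product[OF i] satisfies_def)
  qed
qed

lemma eval_subalgebra:
  assumes "subalgebra B A" "\<And>x. v x \<in> carrier B"
  shows "eval B v t = eval A v t"
proof -
  have "algebra B" using assms(1) by (simp add: subalgebra_def)
  then have "eval B v s \<in> carrier B" for s using eval_closed assms(2) by blast
  with assms(1) have "eval A v t = eval B v t"
    by (induction t) (auto simp: subalgebra_def)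
  then show ?thesis ..
qed

lemma subalgebra_satisfies:
  assumes "subalgebra B A" "satisfies A e"
  shows "satisfies B e"
  unfolding satisfies_def
proof (intro allI impI)
  fix v :: "nat \<Rightarrow> _" assume v: "\<forall>x. v x \<in> carrier B"
  then have "\<forall>x. v x \<in> carrier A" using assms(1) by (auto simp: subalgebra_def)
  then show "eval B v (fst e) = eval B v (snd e)"
    using assms eval_subalgebra[OF assms(1), of v] v by (auto simp: satisfies_def)
qed

section \<open>The algebra of all languages over a type of letters\<close>

definition full_lang :: "'c list set alg" where
  "full_lang = \<lparr>carrier = UNIV, plus_op = (\<union>), times_op = (\<inter>), comp_op = lang_conc,
     zero_el = {}, one_el = {[]}\<rparr>"

lemma full_lang_simps [simp]:
  "carrier full_lang = UNIV" "plus_op full_lang = (\<union>)" "times_op full_lang = (\<inter>)"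
  "comp_op full_lang = lang_conc" "zero_el full_lang = {}" "one_el full_lang = {[]}"
  by (simp_all add: full_lang_def)

lemma full_lang_in_Lang: "full_lang \<in> Lang"
  by (auto simp: Lang_def language_algebra_def algebra_def intro!: exI[of _ UNIV])

lemma Lang_subalgebra_full_lang: "A \<in> Lang \<Longrightarrow> subalgebra A full_lang"
  by (auto simp: Lang_def language_algebra_def subalgebra_def)

lemma lang_conc_assoc: "lang_conc (lang_conc a b) c = lang_conc a (lang_conc b c)"
  unfolding lang_conc_def by (auto; metis append_assoc)

lemma lang_conc_simps [simp]:
  "lang_conc {} a = {}" "lang_conc a {} = {}" "lang_conc {[]} a = a" "lang_conc a {[]} = a"
  "lang_conc (a \<union> b) c = lang_conc a c \<union> lang_conc b c"
  "lang_conc a (b \<union> c) = lang_conc a b \<union> lang_conc a c"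
  "[] \<in> lang_conc a b \<longleftrightarrow> [] \<in> a \<and> [] \<in> b"
  by (auto simp: lang_conc_def)

lemma lang_conc_mono: "a \<subseteq> a' \<Longrightarrow> b \<subseteq> b' \<Longrightarrow> lang_conc a b \<subseteq> lang_conc a' b'"
  by (auto simp: lang_conc_def)

text \<open>This turns each axiom about elements below \<open>1\<close> into a case distinction on
  whether \<open>[]\<close> belongs to the languages involved.\<close>

lemma Int_eps:
  "{[]} \<inter> a = (if [] \<in> a then {[]} else {})" "a \<inter> {[]} = (if [] \<in> a then {[]} else {})"
  by auto

lemma full_lang_satisfies:
  assumes "e \<in> {(X \<otimes> Y) \<odot> \<one> \<doteq> (X \<odot> \<one>) \<otimes> (Y \<odot> \<one>)} \<union> Ax\<^sub>i"
  shows "satisfies full_lang e"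
  unfolding satisfies_def
proof (intro allI impI)
  fix v :: "nat \<Rightarrow> 'a list set"
  show "eval full_lang v (fst e) = eval full_lang v (snd e)"
    using assms unfolding Ax\<^sub>i_def distributive_lattice_axioms_def monoid_axioms_def
    by (elim UnE insertE emptyE; simp only: fst_conv snd_conv eval.simps full_lang_simps)
      (simp add: Int_eps; fail | simp add: lang_conc_assoc Int_absorb2 lang_conc_mono; fail | blast)+
qed

lemma Lang_subset_models:
  "Lang \<subseteq> models ({(X \<otimes> Y) \<odot> \<one> \<doteq> (X \<odot> \<one>) \<otimes> (Y \<odot> \<one>)} \<union> Ax\<^sub>i)"
proof
  fix A :: "'a list set alg" assume "A \<in> Lang"
  then have sub: "subalgebra A full_lang" by (rule Lang_subalgebra_full_lang)
  then have "algebra A" by (simp add: subalgebra_def)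
  then show "A \<in> models ({(X \<otimes> Y) \<odot> \<one> \<doteq> (X \<odot> \<one>) \<otimes> (Y \<odot> \<one>)} \<union> Ax\<^sub>i)"
    using subalgebra_satisfies[OF sub full_lang_satisfies] unfolding models_def by blast
qed

section \<open>Homomorphic images and the generated variety\<close>

lemma eval_homomorphism:
  assumes "algebra B" "homomorphism h B A" "\<And>x. v x \<in> carrier B"
  shows "h (eval B v t) = eval A (\<lambda>x. h (v x)) t"
proof -
  have "eval B v s \<in> carrier B" for s using eval_closed assms(1,3) by blast
  with assms(2) show ?thesis by (induction t) (auto simp: homomorphism_def)
qed

lemma homomorphic_image_satisfies:
  assumes "algebra B" "homomorphism h B A" "h ` carrier B = carrier A" "satisfies B e"
  shows "satisfies A e"
  unfolding satisfies_def
proof (intro allI impI)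
  fix v :: "nat \<Rightarrow> _" assume "\<forall>x. v x \<in> carrier A"
  then have "\<forall>x. \<exists>b. b \<in> carrier B \<and> h b = v x" using assms(3) by (metis imageE)
  then obtain u where u: "\<And>x. u x \<in> carrier B" "\<And>x. h (u x) = v x" by metis
  have "h (eval B u (fst e)) = h (eval B u (snd e))"
    using assms(4) u(1) by (auto simp: satisfies_def)
  then show "eval A v (fst e) = eval A v (snd e)"
    by (simp add: eval_homomorphism[OF assms(1,2) u(1)] u(2))
qed

text \<open>The easy half of Birkhoff's theorem: products, subalgebras and homomorphic images each
  preserve equations.\<close>

lemma generated_variety_subset_models:
  assumes "K \<subseteq> models E"
  shows "generated_variety TYPE('i) K \<subseteq> models E"
proof
  fix A assume "A \<in> generated_variety TYPE('i) K"
  then obtain B I h and F :: "'i \<Rightarrow> _" where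
    A: "algebra A" "homomorphism h B A" "h ` carrier B = carrier A"
      and B: "subalgebra B (product_alg I F)" and F: "\<forall>i\<in>I. F i \<in> K"
    unfolding generated_variety_def \<H>_def \<S>_def \<P>_def by blast
  have "satisfies (product_alg I F) e" if "e \<in> E" for e
    by (rule product_satisfies) (use that F assms in \<open>auto simp: models_def\<close>)
  then have "satisfies A e" if "e \<in> E" for e
    using that A B homomorphic_image_satisfies subalgebra_satisfies
    by (metis subalgebra_def)
  then show "A \<in> models E" using A by (simp add: models_def)
qed

section \<open>Consequences of the axioms\<close>

locale lang_model =
  fixes A :: "'a alg"
  assumes model: "A \<in> models ({(X \<otimes> Y) \<odot> \<one> \<doteq> (X \<odot> \<one>) \<otimes> (Y \<odot> \<one>)} \<union> Ax\<^sub>i)"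
begin

abbreviation add (infixl "\<squnion>" 65) where "x \<squnion> y \<equiv> plus_op A x y"
abbreviation mul (infixl "\<sqinter>" 70) where "x \<sqinter> y \<equiv> times_op A x y"
abbreviation cmp (infixl "\<bullet>" 75) where "x \<bullet> y \<equiv> comp_op A x y"
abbreviation id1 ("\<ii>") where "\<ii> \<equiv> one_el A"
abbreviation U where "U \<equiv> carrier A"

definition le (infix "\<sqsubseteq>" 50) where "x \<sqsubseteq> y \<longleftrightarrow> x \<sqinter> y = x"

lemma alg: "algebra A"
  using model by (simp add: models_def)

lemma closed [simp, intro]:
  "zero_el A \<in> U" "\<ii> \<in> U"
  "x \<in> U \<Longrightarrow> y \<in> U \<Longrightarrow> x \<squnion> y \<in> U"
  "x \<in> U \<Longrightarrow> y \<in> U \<Longrightarrow> x \<sqinter> y \<in> U"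
  "x \<in> U \<Longrightarrow> y \<in> U \<Longrightarrow> x \<bullet> y \<in> U"
  using alg by (auto simp: algebra_def)

text \<open>The axioms mention only the variables 0 to 4, so five elements fix the valuation. The
  laws below are instances of this lemma, with repeated arguments where fewer variables
  occur.\<close>

lemma law:
  assumes "(s, t) \<in> {(X \<otimes> Y) \<odot> \<one> \<doteq> (X \<odot> \<one>) \<otimes> (Y \<odot> \<one>)} \<union> Ax\<^sub>i"
    and "x \<in> U" "y \<in> U" "z \<in> U" "x' \<in> U" "y' \<in> U"
  defines "v \<equiv> (\<lambda>n::nat. if n = 0 then x else if n = 1 then y else if n = 2 then z
      else if n = 3 then x' else y')"
  shows "eval A v s = eval A v t"
proof -
  have "\<forall>n. v n \<in> U" using assms by auto
  moreover have "satisfies A (s, t)" using model assms(1) by (auto simp: models_def)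
  ultimately show ?thesis unfolding satisfies_def by (metis fst_conv snd_conv)
qed

lemmas ax_defs = Ax\<^sub>i_def distributive_lattice_axioms_def monoid_axioms_def

context
  fixes x y z
  assumes xyz: "x \<in> U" "y \<in> U" "z \<in> U"
begin

lemmas law' = law[OF _ xyz xyz(1,2)]

lemma add_assoc: "(x \<squnion> y) \<squnion> z = x \<squnion> (y \<squnion> z)"
  using law'[of "(X \<oplus> Y) \<oplus> Z" "X \<oplus> (Y \<oplus> Z)"] by (simp add: ax_defs)
lemma mul_assoc: "(x \<sqinter> y) \<sqinter> z = x \<sqinter> (y \<sqinter> z)"
  using law'[of "(X \<odot> Y) \<odot> Z" "X \<odot> (Y \<odot> Z)"] by (simp add: ax_defs)
lemma mul_add_distrib: "x \<sqinter> (y \<squnion> z) = x \<sqinter> y \<squnion> x \<sqinter> z"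
  using law'[of "X \<odot> (Y \<oplus> Z)" "X \<odot> Y \<oplus> X \<odot> Z"] by (simp add: ax_defs)
lemma cmp_assoc: "(x \<bullet> y) \<bullet> z = x \<bullet> (y \<bullet> z)"
  using law'[of "(X \<otimes> Y) \<otimes> Z" "X \<otimes> (Y \<otimes> Z)"] by (simp add: ax_defs)
lemma cmp_id_mul: "(\<ii> \<sqinter> x) \<bullet> (y \<sqinter> z) = ((\<ii> \<sqinter> x) \<bullet> y) \<sqinter> z"
  using law'[of "(\<one> \<odot> X) \<otimes> (Y \<odot> Z)" "((\<one> \<odot> X) \<otimes> Y) \<odot> Z"] by (simp add: ax_defs)
lemma add_cmp_distrib: "(x \<squnion> y) \<bullet> z = x \<bullet> z \<squnion> y \<bullet> z"
  using law'[of "(X \<oplus> Y) \<otimes> Z" "X \<otimes> Z \<oplus> Y \<otimes> Z"] by (simp add: ax_defs)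
lemma cmp_add_distrib: "x \<bullet> (y \<squnion> z) = x \<bullet> y \<squnion> x \<bullet> z"
  using law'[of "X \<otimes> (Y \<oplus> Z)" "X \<otimes> Y \<oplus> X \<otimes> Z"] by (simp add: ax_defs)

end

context
  fixes x y
  assumes xy: "x \<in> U" "y \<in> U"
begin

lemmas law'' = law[OF _ xy xy(1) xy(1,2)]

lemma add_commute: "x \<squnion> y = y \<squnion> x"
  using law''[of "X \<oplus> Y" "Y \<oplus> X"] by (simp add: ax_defs)
lemma mul_commute: "x \<sqinter> y = y \<sqinter> x"
  using law''[of "X \<odot> Y" "Y \<odot> X"] by (simp add: ax_defs)
lemma add_absorb: "x \<squnion> x \<sqinter> y = x"
  using law''[of "X \<oplus> X \<odot> Y" "X"] by (simp add: ax_defs)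
lemma mul_absorb: "x \<sqinter> (x \<squnion> y) = x"
  using law''[of "X \<odot> (X \<oplus> Y)" "X"] by (simp add: ax_defs)
lemma cmp_ids: "(\<ii> \<sqinter> x) \<bullet> (\<ii> \<sqinter> y) = \<ii> \<sqinter> x \<sqinter> y"
  using law''[of "(\<one> \<odot> X) \<otimes> (\<one> \<odot> Y)" "\<one> \<odot> X \<odot> Y"] by (simp add: ax_defs)
lemma cmp_id_commute: "(\<ii> \<sqinter> x) \<bullet> y = y \<bullet> (\<ii> \<sqinter> x)"
  using law''[of "(\<one> \<odot> X) \<otimes> Y" "Y \<otimes> (\<one> \<odot> X)"] by (simp add: ax_defs)
lemma mul_id_cmp: "(x \<bullet> y) \<sqinter> \<ii> = (x \<sqinter> \<ii>) \<bullet> (y \<sqinter> \<ii>)"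
  using law''[of "(X \<otimes> Y) \<odot> \<one>" "(X \<odot> \<one>) \<otimes> (Y \<odot> \<one>)"] by simp

end

context
  fixes x
  assumes x: "x \<in> U"
begin

lemmas law''' = law[OF _ x x x x x]

lemma mul_idem: "x \<sqinter> x = x"
  using law'''[of "X \<odot> X" "X"] by (simp add: ax_defs)
lemma id_cmp: "\<ii> \<bullet> x = x"
  using law'''[of "\<one> \<otimes> X" "X"] by (simp add: ax_defs)
lemma cmp_id: "x \<bullet> \<ii> = x"
  using law'''[of "X \<otimes> \<one>" "X"] by (simp add: ax_defs)
lemma zero_mul: "zero_el A \<sqinter> x = zero_el A"
  using law'''[of "\<zero>" "\<zero> \<odot> X"] by (simp add: ax_defs)
lemma zero_cmp: "zero_el A \<bullet> x = zero_el A"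
  using law'''[of "\<zero>" "\<zero> \<otimes> X"] by (simp add: ax_defs)
lemma cmp_zero: "x \<bullet> zero_el A = zero_el A"
  using law'''[of "\<zero>" "\<zero> \<otimes> X"] law'''[of "\<zero> \<otimes> X" "X \<otimes> \<zero>"] by (simp add: ax_defs)

end

lemma cmp_mul_le:
  assumes "x \<in> U" "x' \<in> U" "y \<in> U" "y' \<in> U"
  shows "((x \<sqinter> x') \<bullet> (y \<sqinter> y')) \<sqinter> (x \<bullet> y) = (x \<sqinter> x') \<bullet> (y \<sqinter> y')"
  using law[of "(X \<odot> X') \<otimes> (Y \<odot> Y') \<odot> (X \<otimes> Y)" "(X \<odot> X') \<otimes> (Y \<odot> Y')" x y x x' y'] assms
  by (simp add: ax_defs)

section \<open>The lattice order and monotonicity\<close>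

lemma le_refl [simp]: "x \<in> U \<Longrightarrow> x \<sqsubseteq> x"
  by (simp add: le_def mul_idem)

lemma le_trans: "x \<sqsubseteq> y \<Longrightarrow> y \<sqsubseteq> z \<Longrightarrow> x \<in> U \<Longrightarrow> y \<in> U \<Longrightarrow> z \<in> U \<Longrightarrow> x \<sqsubseteq> z"
  unfolding le_def by (metis mul_assoc)

lemma le_antisym: "x \<sqsubseteq> y \<Longrightarrow> y \<sqsubseteq> x \<Longrightarrow> x \<in> U \<Longrightarrow> y \<in> U \<Longrightarrow> x = y"
  unfolding le_def by (metis mul_commute)

lemma mul_le1: "x \<in> U \<Longrightarrow> y \<in> U \<Longrightarrow> x \<sqinter> y \<sqsubseteq> x"
  unfolding le_def by (metis mul_assoc mul_commute mul_idem)

lemma mul_le2: "x \<in> U \<Longrightarrow> y \<in> U \<Longrightarrow> x \<sqinter> y \<sqsubseteq> y"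
  unfolding le_def by (metis mul_assoc mul_idem)

lemma mul_greatest: "z \<sqsubseteq> x \<Longrightarrow> z \<sqsubseteq> y \<Longrightarrow> x \<in> U \<Longrightarrow> y \<in> U \<Longrightarrow> z \<in> U \<Longrightarrow> z \<sqsubseteq> x \<sqinter> y"
  unfolding le_def by (metis mul_assoc)

lemma le_add1: "x \<in> U \<Longrightarrow> y \<in> U \<Longrightarrow> x \<sqsubseteq> x \<squnion> y"
  unfolding le_def by (rule mul_absorb)

lemma le_add2: "x \<in> U \<Longrightarrow> y \<in> U \<Longrightarrow> y \<sqsubseteq> x \<squnion> y"
  by (metis le_add1 add_commute)

lemma add_least: "x \<sqsubseteq> z \<Longrightarrow> y \<sqsubseteq> z \<Longrightarrow> x \<in> U \<Longrightarrow> y \<in> U \<Longrightarrow> z \<in> U \<Longrightarrow> x \<squnion> y \<sqsubseteq> z"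
  unfolding le_def by (metis closed(3) mul_add_distrib mul_commute)

lemma add_mul_distrib:
  "x \<in> U \<Longrightarrow> y \<in> U \<Longrightarrow> z \<in> U \<Longrightarrow> (x \<squnion> y) \<sqinter> z = x \<sqinter> z \<squnion> y \<sqinter> z"
  by (metis closed(3) mul_add_distrib mul_commute)

lemma mul_zero: "x \<in> U \<Longrightarrow> x \<sqinter> zero_el A = zero_el A"
  by (metis closed(1) mul_commute zero_mul)

lemma zero_le: "x \<in> U \<Longrightarrow> zero_el A \<sqsubseteq> x"
  by (simp add: le_def zero_mul)

text \<open>The equational form \<open>cmp_mul_le\<close> yields this once \<open>x\<close> is
  written as \<open>x' \<sqinter> x\<close> and \<open>y\<close> as
  \<open>y' \<sqinter> y\<close>.\<close>

lemma cmp_mono: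
  "x \<sqsubseteq> x' \<Longrightarrow> y \<sqsubseteq> y' \<Longrightarrow> x \<in> U \<Longrightarrow> x' \<in> U \<Longrightarrow> y \<in> U \<Longrightarrow> y' \<in> U \<Longrightarrow> x \<bullet> y \<sqsubseteq> x' \<bullet> y'"
  unfolding le_def by (metis cmp_mul_le mul_commute)

section \<open>Elements below the identity\<close>

context
  fixes e
  assumes e: "e \<in> U" "e \<sqsubseteq> \<ii>"
begin

lemma subid_eq: "\<ii> \<sqinter> e = e"
  using e by (metis closed(2) le_def mul_commute)

lemma subid_commute: "x \<in> U \<Longrightarrow> e \<bullet> x = x \<bullet> e"
  using cmp_id_commute[OF e(1)] by (simp add: subid_eq)

lemma subid_mul: "x \<in> U \<Longrightarrow> y \<in> U \<Longrightarrow> e \<bullet> (x \<sqinter> y) = (e \<bullet> x) \<sqinter> y"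
  using cmp_id_mul[OF e(1)] by (simp add: subid_eq)

lemma subid_cmp_eq_mul: "f \<in> U \<Longrightarrow> f \<sqsubseteq> \<ii> \<Longrightarrow> e \<bullet> f = e \<sqinter> f"
  using cmp_ids[OF e(1), of f] subid_eq by (metis closed(2) le_def mul_commute)

lemma subid_idem: "e \<bullet> e = e"
  using subid_cmp_eq_mul e mul_idem by simp

lemma subid_cmp_le: "x \<in> U \<Longrightarrow> e \<bullet> x \<sqsubseteq> x"
  using cmp_mono[of e \<ii> x x] e id_cmp by simp

lemma subid_cmp_cmp:
  assumes "f \<in> U" "x \<in> U" "y \<in> U"
  shows "(e \<bullet> x) \<bullet> (f \<bullet> y) = x \<bullet> ((e \<bullet> f) \<bullet> y)"
  using assms e by (simp add: subid_commute[of x] cmp_assoc)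

lemma subid_distrib: "x \<in> U \<Longrightarrow> y \<in> U \<Longrightarrow> (e \<bullet> x) \<bullet> (e \<bullet> y) = e \<bullet> (x \<bullet> y)"
  using subid_cmp_cmp[of e x y] e subid_idem by (simp add: cmp_assoc[symmetric] subid_commute[of x])

lemma subid_absorb: "x \<in> U \<Longrightarrow> e \<bullet> (e \<bullet> x) = e \<bullet> x"
  using e subid_idem by (simp add: cmp_assoc[symmetric])

end

text \<open>By \<open>subid_mul\<close> a factor below \<open>\<ii>\<close> can be pulled out of
  either argument of a meet.\<close>

lemma subid_mul_mul:
  assumes "e \<in> U" "e \<sqsubseteq> \<ii>" "f \<in> U" "f \<sqsubseteq> \<ii>" "x \<in> U" "y \<in> U"
  shows "(e \<bullet> x) \<sqinter> (f \<bullet> y) = (e \<bullet> f) \<bullet> (x \<sqinter> y)"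
proof -
  have "(e \<bullet> x) \<sqinter> (f \<bullet> y) = e \<bullet> ((f \<bullet> y) \<sqinter> x)"
    using assms by (simp add: subid_mul[symmetric] mul_commute)
  also have "(f \<bullet> y) \<sqinter> x = f \<bullet> (y \<sqinter> x)"
    using assms by (simp add: subid_mul)
  also have "y \<sqinter> x = x \<sqinter> y" using assms by (simp add: mul_commute)
  finally show ?thesis using assms by (simp add: cmp_assoc)
qed

end

section \<open>Normal forms\<close>

text \<open>In the graph reading, \<open>PMeet\<close> is parallel and \<open>PComp\<close> serial
  composition.\<close>

datatype 'v pterm = PVar 'v | PMeet "'v pterm" "'v pterm" | PComp "'v pterm" "'v pterm"

primrec trm_of :: "'v pterm \<Rightarrow> 'v trm" where
  "trm_of (PVar x) = Var x"
| "trm_of (PMeet p q) = trm_of p \<odot> trm_of q"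
| "trm_of (PComp p q) = trm_of p \<otimes> trm_of q"

primrec pvars :: "'v pterm \<Rightarrow> 'v list" where
  "pvars (PVar x) = [x]"
| "pvars (PMeet p q) = pvars p @ pvars q"
| "pvars (PComp p q) = pvars p @ pvars q"

primrec subid_trm :: "'v list \<Rightarrow> 'v trm" where
  "subid_trm [] = \<one>"
| "subid_trm (x # C) = Var x \<odot> subid_trm C"

text \<open>\<open>None\<close> stands for a missing second factor; the constant \<open>1\<close> is
  not expressible as a \<open>pterm\<close>.\<close>

type_synonym 'v nform = "'v list \<times> 'v pterm option"

fun nform_trm :: "'v nform \<Rightarrow> 'v trm" where
  "nform_trm (C, None) = subid_trm C"
| "nform_trm (C, Some p) = subid_trm C \<otimes> trm_of p"

text \<open>If one argument lies below \<open>1\<close>, so does the meet. The positive term of the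
  other argument is then cut down to \<open>1\<close>, and only its list of variables
  remains.\<close>

fun nform_meet :: "'v nform \<Rightarrow> 'v nform \<Rightarrow> 'v nform" where
  "nform_meet (C, None) (D, None) = (C @ D, None)"
| "nform_meet (C, None) (D, Some q) = (C @ D @ pvars q, None)"
| "nform_meet (C, Some p) (D, None) = (C @ D @ pvars p, None)"
| "nform_meet (C, Some p) (D, Some q) = (C @ D, Some (PMeet p q))"

fun nform_comp :: "'v nform \<Rightarrow> 'v nform \<Rightarrow> 'v nform" where
  "nform_comp (C, None) (D, n) = (C @ D, n)"
| "nform_comp (C, Some p) (D, None) = (C @ D, Some p)"
| "nform_comp (C, Some p) (D, Some q) = (C @ D, Some (PComp p q))"

primrec nforms :: "'v trm \<Rightarrow> 'v nform list" where
  "nforms (Var x) = [([], Some (PVar x))]"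
| "nforms \<zero> = []"
| "nforms \<one> = [([], None)]"
| "nforms (s \<oplus> t) = nforms s @ nforms t"
| "nforms (s \<odot> t) = [nform_meet m n. m \<leftarrow> nforms s, n \<leftarrow> nforms t]"
| "nforms (s \<otimes> t) = [nform_comp m n. m \<leftarrow> nforms s, n \<leftarrow> nforms t]"

context lang_model
begin

section \<open>Expansion of terms into sums of normal forms\<close>

primrec add_list :: "'a list \<Rightarrow> 'a" where
  "add_list [] = zero_el A"
| "add_list (x # xs) = x \<squnion> add_list xs"

lemma add_list_closed [simp]: "set xs \<subseteq> U \<Longrightarrow> add_list xs \<in> U"
  by (induction xs) auto

lemma zero_add: "x \<in> U \<Longrightarrow> zero_el A \<squnion> x = x"
  by (metis add_absorb add_commute closed(1) mul_commute zero_mul)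

lemma add_zero: "x \<in> U \<Longrightarrow> x \<squnion> zero_el A = x"
  by (metis add_commute closed(1) zero_add)

lemma add_list_append:
  "set xs \<subseteq> U \<Longrightarrow> set ys \<subseteq> U \<Longrightarrow> add_list (xs @ ys) = add_list xs \<squnion> add_list ys"
  by (induction xs) (auto simp: zero_add add_assoc)

lemma add_list_least:
  "set xs \<subseteq> U \<Longrightarrow> u \<in> U \<Longrightarrow> (\<And>x. x \<in> set xs \<Longrightarrow> x \<sqsubseteq> u) \<Longrightarrow> add_list xs \<sqsubseteq> u"
  by (induction xs) (auto simp: zero_le intro: add_least)

lemma add_list_upper: "set xs \<subseteq> U \<Longrightarrow> x \<in> set xs \<Longrightarrow> x \<sqsubseteq> add_list xs"
proof (induction xs)
  case (Cons y xs)
  then show ?case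
    using le_add1[of y "add_list xs"] le_add2[of y "add_list xs"]
      le_trans[of x "add_list xs" "y \<squnion> add_list xs"] by auto
qed simp

text \<open>Kept general in \<open>f\<close> because meet and composition both expand over sums in
  this way.\<close>

lemma add_list_bilinear:
  assumes "\<And>x y. x \<in> U \<Longrightarrow> y \<in> U \<Longrightarrow> f x y \<in> U"
    and "\<And>x y z. x \<in> U \<Longrightarrow> y \<in> U \<Longrightarrow> z \<in> U \<Longrightarrow> f (x \<squnion> y) z = f x z \<squnion> f y z"
    and "\<And>x y z. x \<in> U \<Longrightarrow> y \<in> U \<Longrightarrow> z \<in> U \<Longrightarrow> f x (y \<squnion> z) = f x y \<squnion> f x z"
    and "\<And>x. x \<in> U \<Longrightarrow> f (zero_el A) x = zero_el A"
    and "\<And>x. x \<in> U \<Longrightarrow> f x (zero_el A) = zero_el A"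
    and "set xs \<subseteq> U" "set ys \<subseteq> U"
  shows "f (add_list xs) (add_list ys) = add_list [f x y. x \<leftarrow> xs, y \<leftarrow> ys]"
proof -
  have 1: "f x (add_list ys) = add_list (map (f x) ys)" if "x \<in> U" for x
    using assms(7) by (induction ys) (auto simp: that assms)
  show ?thesis using assms(6)
  proof (induction xs)
    case Nil
    then show ?case by (simp add: assms)
  next
    case (Cons x xs)
    have "set (map (f x) ys) \<subseteq> U" "set [f x y. x \<leftarrow> xs, y \<leftarrow> ys] \<subseteq> U"
      using Cons.prems assms(1,7) by auto
    with Cons 1[of x] show ?case by (simp add: assms add_list_append)
  qed
qed

context
  fixes val :: "'v \<Rightarrow> 'a"
  assumes val [simp]: "\<And>x. val x \<in> U"
begin

lemma ev_closed [simp]: "eval A val t \<in> U"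
  by (rule eval_closed[OF alg val])

lemma subid_trm_le: "eval A val (subid_trm C) \<sqsubseteq> \<ii>"
  by (induction C) (auto intro: le_trans[OF mul_le2])

lemma subid_trm_append:
  "eval A val (subid_trm (C @ D)) = eval A val (subid_trm C) \<bullet> eval A val (subid_trm D)"
proof -
  have "eval A val (subid_trm (C @ D)) = eval A val (subid_trm C) \<sqinter> eval A val (subid_trm D)"
    by (induction C) (use subid_trm_le[of D] in \<open>auto simp: subid_eq mul_assoc\<close>)
  then show ?thesis by (simp add: subid_cmp_eq_mul subid_trm_le)
qed

text \<open>Below the identity, meet and composition coincide. The case of \<open>PComp\<close> is
  the one place where the additional equation, as \<open>mul_id_cmp\<close>, is applied.\<close>

lemma mul_id_trm_of: "\<ii> \<sqinter> eval A val (trm_of p) = eval A val (subid_trm (pvars p))"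
proof (induction p)
  case (PVar x)
  then show ?case by (simp add: mul_commute)
next
  case (PMeet p q)
  show ?case
    by (simp add: subid_trm_append flip: PMeet) (simp add: cmp_ids mul_assoc)
next
  case (PComp p q)
  show ?case
    by (simp add: subid_trm_append flip: PComp) (simp add: mul_commute[of \<ii>] mul_id_cmp)
qed

text \<open>Writing \<open>e\<close> as \<open>e \<bullet> \<ii>\<close> makes this an instance of
  \<open>subid_mul_mul\<close>, which leaves the meet of \<open>\<ii>\<close> with the positive
  term.\<close>

lemma subid_mul_nform:
  assumes "e \<in> U" "e \<sqsubseteq> \<ii>"
  shows "e \<sqinter> (eval A val (subid_trm D) \<bullet> eval A val (trm_of p)) =
    e \<bullet> eval A val (subid_trm (D @ pvars p))"
proof -
  have "e \<sqinter> (eval A val (subid_trm D) \<bullet> eval A val (trm_of p)) =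
      (e \<bullet> \<ii>) \<sqinter> (eval A val (subid_trm D) \<bullet> eval A val (trm_of p))"
    using assms by (simp add: cmp_id)
  also have "\<dots> = (e \<bullet> eval A val (subid_trm D)) \<bullet> (\<ii> \<sqinter> eval A val (trm_of p))"
    using assms by (simp add: subid_mul_mul subid_trm_le)
  finally show ?thesis
    using assms by (simp add: mul_id_trm_of subid_trm_append cmp_assoc)
qed

lemma nform_meet:
  "eval A val (nform_trm (nform_meet m n)) = eval A val (nform_trm m) \<sqinter> eval A val (nform_trm n)"
proof (induction m n rule: nform_meet.induct)
  case (1 C D)
  show ?case by (simp add: subid_trm_append) (rule subid_cmp_eq_mul; simp add: subid_trm_le)
next
  case (2 C D q)
  show ?case
    by (simp add: subid_trm_append[of C] del: append_assoc)
      (rule subid_mul_nform[symmetric]; simp add: subid_trm_le)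
next
  case (3 C p D)
  let ?C = "eval A val (subid_trm C)" and ?D = "eval A val (subid_trm D)"
  let ?p = "eval A val (trm_of p)" and ?V = "eval A val (subid_trm (pvars p))"
  have "(?C \<bullet> ?p) \<sqinter> ?D = ?D \<sqinter> (?C \<bullet> ?p)" by (rule mul_commute) simp_all
  also have "\<dots> = ?D \<bullet> (?C \<bullet> ?V)"
    by (subst subid_mul_nform) (simp_all add: subid_trm_le subid_trm_append)
  also have "\<dots> = (?D \<bullet> ?C) \<bullet> ?V" by (simp add: cmp_assoc)
  also have "?D \<bullet> ?C = ?C \<bullet> ?D" by (rule subid_commute) (simp_all add: subid_trm_le)
  finally show ?case by (simp add: subid_trm_append cmp_assoc)
next
  case (4 C p D q)
  show ?case
    by (simp add: subid_trm_append) (rule subid_mul_mul[symmetric]; simp add: subid_trm_le)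
qed

lemma nform_comp:
  "eval A val (nform_trm (nform_comp m n)) = eval A val (nform_trm m) \<bullet> eval A val (nform_trm n)"
proof (induction m n rule: nform_comp.induct)
  case (1 C D n)
  then show ?case by (cases n) (simp_all add: subid_trm_append cmp_assoc)
next
  case (2 C p D)
  then show ?case
    by (simp add: subid_trm_append cmp_assoc)
      (intro arg_cong2[of _ _ _ _ "comp_op A"] refl subid_commute; simp add: subid_trm_le)
next
  case (3 C p D q)
  let ?C = "eval A val (subid_trm C)" and ?D = "eval A val (subid_trm D)"
  let ?p = "eval A val (trm_of p)" and ?q = "eval A val (trm_of q)"
  have "(?C \<bullet> ?D) \<bullet> (?p \<bullet> ?q) = ?C \<bullet> ((?D \<bullet> ?p) \<bullet> ?q)" by (simp add: cmp_assoc)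
  also have "?D \<bullet> ?p = ?p \<bullet> ?D" by (rule subid_commute) (simp_all add: subid_trm_le)
  finally show ?case by (simp add: subid_trm_append cmp_assoc)
qed

lemma eval_nforms: "eval A val t = add_list (map (\<lambda>n. eval A val (nform_trm n)) (nforms t))"
proof (induction t)
  case (Var x)
  then show ?case by (simp add: id_cmp add_zero)
next
  case One
  then show ?case by (simp add: add_zero)
next
  case (Plus s t)
  then show ?case by (simp add: add_list_append image_subset_iff)
next
  case (Times s t)
  have "eval A val (s \<odot> t) = add_list [x \<sqinter> y. x \<leftarrow> map (\<lambda>n. eval A val (nform_trm n)) (nforms s),
      y \<leftarrow> map (\<lambda>n. eval A val (nform_trm n)) (nforms t)]"
    unfolding eval.simps Times
    by (rule add_list_bilinear)
      (auto simp: add_mul_distrib mul_add_distrib mul_zero zero_mul)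
  then show ?case by (simp add: map_concat comp_def nform_meet)
next
  case (Comp s t)
  have "eval A val (s \<otimes> t) = add_list [x \<bullet> y. x \<leftarrow> map (\<lambda>n. eval A val (nform_trm n)) (nforms s),
      y \<leftarrow> map (\<lambda>n. eval A val (nform_trm n)) (nforms t)]"
    unfolding eval.simps Comp
    by (rule add_list_bilinear)
      (auto simp: add_cmp_distrib cmp_add_distrib zero_cmp cmp_zero)
  then show ?case by (simp add: map_concat comp_def nform_comp)
qed simp

end

end

section \<open>Canonical language models\<close>

lemma eval_full_lang_mono:
  assumes "\<And>x. v x \<subseteq> w x"
  shows "eval full_lang v t \<subseteq> eval full_lang w t"
proof (induction t)
  case (Comp s t)
  then show ?case by (simp add: lang_conc_mono)
qed (use assms in auto)

section \<open>Words with distinct letters and their factors\<close>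

lemma map_upt_eq_append:
  assumes "map c [i..<j] = u @ w" "i \<le> j"
  obtains k where "i \<le> k" "k \<le> j" "u = map c [i..<k]" "w = map c [k..<j]"
proof
  have len: "length u + length w = j - i"
    by (metis assms(1) length_append length_map length_upt)
  then show "i \<le> i + length u" "i + length u \<le> j" using assms(2) by auto
  then show "u = map c [i..<i + length u]"
    by (metis append_eq_conv_conj assms(1) take_map take_upt)
  show "w = map c [i + length u..<j]"
    by (metis append_eq_conv_conj assms(1) drop_map drop_upt)
qed

text \<open>The premise \<open>i < j\<close> matters: all empty intervals give the same word
  \<open>[]\<close>. This is why the empty word is treated apart from the filters.\<close>

lemma map_upt_inject:
  assumes "inj c" "map c [i..<j] = map c [k..<l]" "i < j"
  shows "i = k \<and> j = l"
proof -
  have eq: "[i..<j] = [k..<l]" using assms by (simp add: inj_map_eq_map)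
  then have len: "j - i = l - k" by (metis length_upt)
  then have "k < l" using assms(3) by linarith
  with eq assms(3) have "i = k" by (metis hd_upt)
  with len show ?thesis using \<open>i < j\<close> \<open>k < l\<close> by linarith
qed

text \<open>
  \<open>F i j\<close> is the filter of elements that hold at the factor \<open>map c [i..<j]\<close> of a word with
  pairwise distinct letters, empty if the factor carries no information; \<open>e\<close> generates the
  filter at the empty word.
\<close>

locale filter_net = lang_model A for A :: "'a alg" +
  fixes e :: 'a and F :: "nat \<Rightarrow> nat \<Rightarrow> 'a \<Rightarrow> bool"
  assumes less: "F a b x \<Longrightarrow> a < b"
    and mem: "F a b x \<Longrightarrow> x \<in> U"
    and up: "F a b x \<Longrightarrow> x \<sqsubseteq> y \<Longrightarrow> y \<in> U \<Longrightarrow> F a b y"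
    and meet: "F a b x \<Longrightarrow> F a b y \<Longrightarrow> F a b (x \<sqinter> y)"
    and comp: "F a b x \<Longrightarrow> F b c y \<Longrightarrow> F a c (x \<bullet> y)"
    and subid_left: "F a b y \<Longrightarrow> x \<in> U \<Longrightarrow> e \<sqsubseteq> x \<Longrightarrow> F a b (x \<bullet> y)"
    and subid_right: "F a b y \<Longrightarrow> x \<in> U \<Longrightarrow> e \<sqsubseteq> x \<Longrightarrow> F a b (y \<bullet> x)"

context lang_model
begin

text \<open>The canonical valuation. Nonempty factors are governed by \<open>F\<close>, the empty
  word by the principal filter of \<open>e\<close>. No closure condition on \<open>F\<close> is
  built in, so valuations of different nets can be compared.\<close>

definition net_val ::
  "(nat \<Rightarrow> 'c) \<Rightarrow> 'a \<Rightarrow> ('v \<Rightarrow> 'a) \<Rightarrow> (nat \<Rightarrow> nat \<Rightarrow> 'a \<Rightarrow> bool) \<Rightarrow> 'v \<Rightarrow> 'c list set" where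
  "net_val c e val F x =
    {map c [i..<j] | i j. F i j (val x)} \<union> (if e \<sqsubseteq> val x then {[]} else {})"

text \<open>Terms are monotone in their variables. This carries membership of a word from the nets
  of subterms to a combined net.\<close>

lemma eval_net_val_mono:
  assumes "w \<in> eval full_lang (net_val c e val F) t" "\<And>i j x. F i j x \<Longrightarrow> G i j x"
  shows "w \<in> eval full_lang (net_val c e val G) t"
proof -
  have "net_val c e val F x \<subseteq> net_val c e val G x" for x
    unfolding net_val_def using assms(2) by (intro Un_mono order_refl) blast
  then show ?thesis using eval_full_lang_mono[of "net_val c e val F" "net_val c e val G"] assms(1)
    by blast
qed

end

text \<open>A truth lemma in one direction, by induction on \<open>t\<close>: each operation uses a
  closure condition of the net. The converse is not claimed, since the filters need not be
  prime.\<close>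

lemma (in filter_net) net_val_truth:
  fixes val :: "'v \<Rightarrow> 'a" and c :: "nat \<Rightarrow> 'c"
  assumes c: "inj c" and val: "\<And>x. val x \<in> U" and e: "e \<in> U" "e \<sqsubseteq> \<ii>"
  shows "([] \<in> eval full_lang (net_val c e val F) t \<longrightarrow> e \<sqsubseteq> eval A val t) \<and>
    (\<forall>i j. i < j \<longrightarrow> map c [i..<j] \<in> eval full_lang (net_val c e val F) t \<longrightarrow>
      F i j (eval A val t))"
proof (induction t)
  case (Var x)
  show ?case
  proof (intro conjI allI impI)
    assume "[] \<in> eval full_lang (net_val c e val F) (Var x)"
    then show "e \<sqsubseteq> eval A val (Var x)"
      \<comment> \<open>By \<open>less\<close>, the intervals carrying information are nonempty and
        contribute no empty word.\<close>
      using less by (fastforce simp: net_val_def split: if_splits)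
  next
    fix i j :: nat
    assume ij: "i < j" and "map c [i..<j] \<in> eval full_lang (net_val c e val F) (Var x)"
    then obtain k l where "map c [i..<j] = map c [k..<l]" "F k l (val x)"
      by (auto simp: net_val_def split: if_splits)
    then show "F i j (eval A val (Var x))" using map_upt_inject[OF c _ ij] by auto
  qed
next
  case (Plus s t)
  have [simp]: "eval A val t \<in> U" for t by (rule ev_closed[of val, OF val])
  have "eval A val s \<sqsubseteq> eval A val (s \<oplus> t)" "eval A val t \<sqsubseteq> eval A val (s \<oplus> t)"
    by (simp_all add: le_add1 le_add2)
  then have "e \<sqsubseteq> eval A val s \<or> e \<sqsubseteq> eval A val t \<Longrightarrow> e \<sqsubseteq> eval A val (s \<oplus> t)"
    "F i j (eval A val s) \<or> F i j (eval A val t) \<Longrightarrow> F i j (eval A val (s \<oplus> t))" for i j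
    using e by (auto intro: le_trans up[of _ _ "eval A val s"] up[of _ _ "eval A val t"])
  with Plus show ?case by auto
next
  case (Times s t)
  have [simp]: "eval A val t \<in> U" for t by (rule ev_closed[of val, OF val])
  show ?case using Times e by (auto intro: mul_greatest meet)
next
  case (Comp s t)
  have [simp]: "eval A val t \<in> U" for t by (rule ev_closed[of val, OF val])
  let ?V = "eval full_lang (net_val c e val F)"
  show ?case
  proof (intro conjI allI impI)
    assume "[] \<in> ?V (s \<otimes> t)"
    then have "e \<bullet> e \<sqsubseteq> eval A val s \<bullet> eval A val t"
      using Comp e by (auto intro: cmp_mono)
    then show "e \<sqsubseteq> eval A val (s \<otimes> t)" using e by (simp add: subid_idem)
  next
    fix i j :: nat
    assume ij: "i < j" and "map c [i..<j] \<in> ?V (s \<otimes> t)"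
    then obtain u w where "map c [i..<j] = u @ w" and uw: "u \<in> ?V s" "w \<in> ?V t"
      by (auto simp: lang_conc_def)
    then obtain k where k: "i \<le> k" "k \<le> j" "u = map c [i..<k]" "w = map c [k..<j]"
      using ij by (metis map_upt_eq_append less_imp_le)
    \<comment> \<open>If the cut is at an end point, one factor is \<open>[]\<close> and has a value
      above \<open>e\<close>, so \<open>subid_left\<close> or \<open>subid_right\<close> applies. A
      proper cut is handled by \<open>comp\<close>.\<close>
    consider "k = i" | "k = j" | "i < k" "k < j" using k by linarith
    then show "F i j (eval A val (s \<otimes> t))"
    proof cases
      case 1
      then show ?thesis using Comp k uw ij by (auto intro: subid_left)
    next
      case 2
      then show ?thesis using Comp k uw ij by (auto intro: subid_right)
    next
      case 3
      then have "F i k (eval A val s)" "F k j (eval A val t)" using Comp k uw by auto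
      then show ?thesis by (simp add: comp)
    qed
  qed
qed (use e in auto)

section \<open>Construction of nets for positive terms\<close>

context lang_model
begin

text \<open>The net lives on the end points \<open>i\<close>, \<open>j\<close> and inner points in
  the interval \<open>(m, M]\<close>. The whole word carries the principal filter of
  \<open>e \<bullet> p\<close>. Its membership in \<open>p\<close> is demanded separately, because
  \<open>net_val_truth\<close> only leads from words to filters.\<close>

definition net ::
  "'a \<Rightarrow> ('v \<Rightarrow> 'a) \<Rightarrow> (nat \<Rightarrow> 'c) \<Rightarrow> (nat \<Rightarrow> nat \<Rightarrow> 'a \<Rightarrow> bool) \<Rightarrow>
    nat \<Rightarrow> nat \<Rightarrow> nat \<Rightarrow> nat \<Rightarrow> 'v pterm \<Rightarrow> bool" where
  "net e val c F i j m M p \<longleftrightarrow> filter_net A e F \<and>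
    (\<forall>a b x. F a b x \<longrightarrow> (a = i \<or> m < a \<and> a \<le> M) \<and> (b = j \<or> m < b \<and> b \<le> M)) \<and>
    (\<forall>y\<in>U. F i j y \<longleftrightarrow> e \<bullet> eval A val (trm_of p) \<sqsubseteq> y) \<and>
    map c [i..<j] \<in> eval full_lang (net_val c e val F) (trm_of p)"

context
  fixes e :: 'a
  assumes e: "e \<in> U" "e \<sqsubseteq> \<ii>"
begin

lemma principal_mul:
  assumes "z \<in> U" "x \<in> U" "y \<in> U" "e \<bullet> z \<sqsubseteq> x" "e \<bullet> z \<sqsubseteq> y"
  shows "e \<bullet> z \<sqsubseteq> x \<sqinter> y"
  using assms e by (simp add: mul_greatest)

text \<open>The generator absorbs a further factor \<open>e\<close>:
  \<open>e \<bullet> (e \<bullet> z) = e \<bullet> z\<close>.\<close>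

lemma principal_subid_left:
  assumes "z \<in> U" "x \<in> U" "y \<in> U" "e \<bullet> z \<sqsubseteq> y" "e \<sqsubseteq> x"
  shows "e \<bullet> z \<sqsubseteq> x \<bullet> y"
  using cmp_mono[OF assms(5,4)] subid_absorb[OF e assms(1)] assms e by simp

lemma principal_subid_right:
  assumes "z \<in> U" "x \<in> U" "y \<in> U" "e \<bullet> z \<sqsubseteq> y" "e \<sqsubseteq> x"
  shows "e \<bullet> z \<sqsubseteq> y \<bullet> x"
  using cmp_mono[OF assms(4,5)] subid_absorb[OF e assms(1)] subid_commute[OF e, of "e \<bullet> z"] assms e
  by simp

context
  fixes val :: "'v \<Rightarrow> 'a" and c :: "nat \<Rightarrow> 'c"
  assumes val: "\<And>x. val x \<in> U"
begin

lemma net_Var: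
  assumes "i < j"
  shows "net e val c (\<lambda>a b y. a = i \<and> b = j \<and> y \<in> U \<and> e \<bullet> val x \<sqsubseteq> y) i j m M (PVar x)"
proof -
  have v: "val x \<in> U" "e \<bullet> val x \<in> U" "e \<bullet> val x \<sqsubseteq> val x"
    using val e by (auto simp: subid_cmp_le)
  have "filter_net A e (\<lambda>a b y. a = i \<and> b = j \<and> y \<in> U \<and> e \<bullet> val x \<sqsubseteq> y)"
    by unfold_locales
      (use assms v e in \<open>auto intro: le_trans principal_mul principal_subid_left
         principal_subid_right\<close>)
  then show ?thesis using v assms by (auto simp: net_def net_val_def)
qed

text \<open>Parallel composition: the two nets share their end points and have disjoint sets of
  inner points, so their filters interact only at the pair \<open>i\<close>,
  \<open>j\<close>.\<close>

lemma net_Meet: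
  assumes p: "net e val c F i j m M p" and q: "net e val c G i j M N q" and ord: "i \<le> m" "m \<le> M" "M \<le> N" "N < j"
  shows "\<exists>H. net e val c H i j m N (PMeet p q)"
proof -
  let ?p = "eval A val (trm_of p)" and ?q = "eval A val (trm_of q)"
  have pq: "?p \<in> U" "?q \<in> U" "e \<bullet> (?p \<sqinter> ?q) \<in> U" using ev_closed[of val, OF val] e by auto
  interpret F: filter_net A e F using p by (simp add: net_def)
  interpret G: filter_net A e G using q by (simp add: net_def)
  have F: "(a = i \<or> m < a \<and> a \<le> M) \<and> (b = j \<or> m < b \<and> b \<le> M)" if "F a b x" for a b x
    using p that by (auto simp: net_def)
  have G: "(a = i \<or> M < a \<and> a \<le> N) \<and> (b = j \<or> M < b \<and> b \<le> N)" if "G a b x" for a b x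
    using q that by (auto simp: net_def)
  have le: "e \<bullet> (?p \<sqinter> ?q) \<sqsubseteq> e \<bullet> ?p" "e \<bullet> (?p \<sqinter> ?q) \<sqsubseteq> e \<bullet> ?q"
    using pq e by (auto intro!: cmp_mono mul_le1 mul_le2)
  have Fij: "e \<bullet> (?p \<sqinter> ?q) \<sqsubseteq> y" if "F i j y" for y
    using that p F.mem[OF that] le pq e by (auto simp: net_def intro: le_trans[OF le(1)])
  have Gij: "e \<bullet> (?p \<sqinter> ?q) \<sqsubseteq> y" if "G i j y" for y
    using that q G.mem[OF that] le pq e by (auto simp: net_def intro: le_trans[OF le(2)])
  \<comment> \<open>The filters at \<open>i\<close>, \<open>j\<close> are replaced by the principal
    filter of \<open>e \<bullet> (?p \<sqinter> ?q)\<close>, which contains both of them; elsewhere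
    the union is taken.\<close>
  define H where "H a b y \<longleftrightarrow> (a = i \<and> b = j \<and> y \<in> U \<and> e \<bullet> (?p \<sqinter> ?q) \<sqsubseteq> y) \<or>
    (\<not> (a = i \<and> b = j) \<and> (F a b y \<or> G a b y))" for a b y
  have FH: "H a b y" if "F a b y" for a b y
    using that Fij F.mem[OF that] by (auto simp: H_def)
  have GH: "H a b y" if "G a b y" for a b y
    using that Gij G.mem[OF that] by (auto simp: H_def)
  have ends: "a = i \<and> b = j" if "F a b x" "G a b y" for a b x y
    using F[OF that(1)] G[OF that(2)] ord by auto
  have bounds: "i \<le> a \<and> a < b \<and> b \<le> j" if "H a b x" for a b x
    using that ord F[of a b x] G[of a b x] F.less[of a b x] G.less[of a b x]
    by (auto simp: H_def)
  have "filter_net A e H"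
  proof unfold_locales
    fix a b x y
    show "H a b x \<Longrightarrow> a < b" using bounds by auto
    show "H a b x \<Longrightarrow> x \<in> U" using F.mem G.mem by (auto simp: H_def)
    show "H a b y" if "H a b x" "x \<sqsubseteq> y" "y \<in> U"
    proof (cases "a = i \<and> b = j")
      case True
      then show ?thesis using that pq le_trans[of "e \<bullet> (?p \<sqinter> ?q)" x y] by (simp add: H_def)
    next
      case False
      then show ?thesis using that F.up G.up unfolding H_def by blast
    qed
    show "H a b (x \<sqinter> y)" if "H a b x" "H a b y"
    proof (cases "a = i \<and> b = j")
      case True
      then show ?thesis using that pq by (simp add: H_def principal_mul)
    next
      case False
      then show ?thesis using that F.meet G.meet ends unfolding H_def by blast
    qed
    show "H a b (x \<bullet> y)" if "H a b y" "x \<in> U" "e \<sqsubseteq> x"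
    proof (cases "a = i \<and> b = j")
      case True
      then show ?thesis using that pq by (simp add: H_def principal_subid_left)
    next
      case False
      then show ?thesis using that F.subid_left G.subid_left unfolding H_def by blast
    qed
    show "H a b (y \<bullet> x)" if "H a b y" "x \<in> U" "e \<sqsubseteq> x"
    proof (cases "a = i \<and> b = j")
      case True
      then show ?thesis using that pq by (simp add: H_def principal_subid_right)
    next
      case False
      then show ?thesis using that F.subid_right G.subid_right unfolding H_def by blast
    qed
  next
    fix a b d x y
    assume H: "H a b x" "H b d y"
    \<comment> \<open>The middle point \<open>b\<close> lies strictly between \<open>i\<close> and
      \<open>j\<close>, hence is an inner point of exactly one net, and both factors come from that
      net.\<close>
    have lt: "i \<le> a" "a < b" "b < d" "d \<le> j" using H bounds by auto
    then have "F a b x \<or> G a b x" "F b d y \<or> G b d y" using H by (auto simp: H_def)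
    moreover have False if "F a b x" "G b d y" using F[OF that(1)] G[OF that(2)] lt by auto
    moreover have False if "G a b x" "F b d y" using G[OF that(1)] F[OF that(2)] lt by auto
    ultimately show "H a d (x \<bullet> y)" using FH[OF F.comp] GH[OF G.comp] by blast
  qed
  moreover have "(a = i \<or> m < a \<and> a \<le> N) \<and> (b = j \<or> m < b \<and> b \<le> N)" if "H a b x" for a b x
    using that F[of a b x] G[of a b x] ord by (auto simp: H_def)
  moreover have "map c [i..<j] \<in> eval full_lang (net_val c e val H) (trm_of (PMeet p q))"
    using p q FH GH by (auto simp: net_def elim!: eval_net_val_mono)
  ultimately have "net e val c H i j m N (PMeet p q)" by (auto simp: net_def H_def)
  then show ?thesis by blast
qed

text \<open>Serial composition at \<open>k\<close>: the net of \<open>p\<close> ends where that of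
  \<open>q\<close> begins, and intervals crossing \<open>k\<close> receive new filters.\<close>

lemma net_Comp:
  assumes p: "net e val c F i k m M p" and q: "net e val c G k j k N q" and ord: "i \<le> m" "m \<le> M" "M < k" "k \<le> N" "N < j"
  shows "\<exists>H. net e val c H i j m N (PComp p q)"
proof -
  let ?p = "eval A val (trm_of p)" and ?q = "eval A val (trm_of q)"
  have pq: "?p \<in> U" "?q \<in> U" using ev_closed[of val, OF val] by auto
  interpret F: filter_net A e F using p by (simp add: net_def)
  interpret G: filter_net A e G using q by (simp add: net_def)
  have F: "(a = i \<or> m < a \<and> a \<le> M) \<and> (b = k \<or> m < b \<and> b \<le> M)" if "F a b x" for a b x
    using p that by (auto simp: net_def)
  have G: "(a = k \<or> k < a \<and> a \<le> N) \<and> (b = j \<or> k < b \<and> b \<le> N)" if "G a b x" for a b x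
    using q that by (auto simp: net_def)
  have Fle: "a < k \<and> b \<le> k" if "F a b x" for a b x using F[OF that] F.less[OF that] ord by auto
  have Gle: "k \<le> a \<and> k < b" if "G a b x" for a b x using G[OF that] G.less[OF that] ord by auto
  \<comment> \<open>On an interval crossing \<open>k\<close>, the filter is the upward closure of
    the products of information to the left and to the right of \<open>k\<close>.\<close>
  define J where "J a b y \<longleftrightarrow> y \<in> U \<and> (\<exists>u w. F a k u \<and> G k b w \<and> u \<bullet> w \<sqsubseteq> y)" for a b y
  define H where "H a b y \<longleftrightarrow> F a b y \<or> G a b y \<or> J a b y" for a b y
  have Jle: "a < k \<and> k < b" if "J a b x" for a b x
    using that Fle Gle by (auto simp: J_def)
  have J_up: "J a b y" if "J a b x" "x \<sqsubseteq> y" "y \<in> U" for a b x y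
    using that F.mem G.mem unfolding J_def by (meson closed(5) le_trans)
  have J_meet: "J a b (x \<sqinter> y)" if xy: "J a b x" "J a b y" for a b x y
  proof -
    obtain u w u' w' where *: "F a k u" "G k b w" "u \<bullet> w \<sqsubseteq> x" "F a k u'" "G k b w'" "u' \<bullet> w' \<sqsubseteq> y"
      and U: "x \<in> U" "y \<in> U" using xy by (auto simp: J_def)
    have U': "u \<in> U" "w \<in> U" "u' \<in> U" "w' \<in> U" using * F.mem G.mem by auto
    have "(u \<sqinter> u') \<bullet> (w \<sqinter> w') \<sqsubseteq> u \<bullet> w" "(u \<sqinter> u') \<bullet> (w \<sqinter> w') \<sqsubseteq> u' \<bullet> w'"
      using U' by (auto intro!: cmp_mono mul_le1 mul_le2)
    then have "(u \<sqinter> u') \<bullet> (w \<sqinter> w') \<sqsubseteq> x" "(u \<sqinter> u') \<bullet> (w \<sqinter> w') \<sqsubseteq> y"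
      using U U' *(3,6) by (meson closed le_trans)+
    then have "(u \<sqinter> u') \<bullet> (w \<sqinter> w') \<sqsubseteq> x \<sqinter> y" using U U' by (simp add: mul_greatest)
    moreover have "F a k (u \<sqinter> u')" "G k b (w \<sqinter> w')" using * F.meet G.meet by auto
    ultimately show ?thesis using U unfolding J_def by blast
  qed
  \<comment> \<open>The premise \<open>F'\<close> serves two purposes: it follows from
    \<open>F.comp\<close> if \<open>x\<close> satisfies \<open>F a b\<close>, and from
    \<open>F.subid_left\<close> if \<open>a = b\<close> and \<open>x\<close> is above
    \<open>e\<close>. \<open>JG\<close> is the mirror image.\<close>
  have FJ: "J a d (x \<bullet> y)" if xy: "x \<in> U" "J b d y" and F': "\<And>u. F b k u \<Longrightarrow> F a k (x \<bullet> u)" for a b d x y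
  proof -
    obtain u w where *: "F b k u" "G k d w" "u \<bullet> w \<sqsubseteq> y" and "y \<in> U"
      using xy by (auto simp: J_def)
    moreover have U: "u \<in> U" "w \<in> U" using * F.mem G.mem by auto
    ultimately have "(x \<bullet> u) \<bullet> w \<sqsubseteq> x \<bullet> y" using xy by (simp add: cmp_assoc cmp_mono)
    then show ?thesis using * \<open>y \<in> U\<close> F' xy by (auto simp: J_def)
  qed
  have JG: "J a d (x \<bullet> y)" if xy: "J a b x" "y \<in> U" and G': "\<And>w. G k b w \<Longrightarrow> G k d (w \<bullet> y)" for a b d x y
  proof -
    obtain u w where *: "F a k u" "G k b w" "u \<bullet> w \<sqsubseteq> x" and "x \<in> U"
      using xy by (auto simp: J_def)
    moreover have U: "u \<in> U" "w \<in> U" using * F.mem G.mem by auto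
    ultimately have "u \<bullet> (w \<bullet> y) \<sqsubseteq> x \<bullet> y" using xy by (simp add: cmp_assoc[symmetric] cmp_mono)
    then show ?thesis using * \<open>x \<in> U\<close> G' xy by (auto simp: J_def)
  qed
  have "filter_net A e H"
  proof unfold_locales
    fix a b x y
    show "H a b x \<Longrightarrow> a < b" using F.less G.less Jle by (fastforce simp: H_def)
    show "H a b x \<Longrightarrow> x \<in> U" using F.mem G.mem by (auto simp: H_def J_def)
    show "H a b x \<Longrightarrow> x \<sqsubseteq> y \<Longrightarrow> y \<in> U \<Longrightarrow> H a b y"
      using F.up G.up J_up by (auto simp: H_def)
    show "H a b x \<Longrightarrow> H a b y \<Longrightarrow> H a b (x \<sqinter> y)"
      using F.meet[of a b x y] G.meet[of a b x y] J_meet[of a b x y]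
        Fle[of a b x] Gle[of a b x] Jle[of a b x] Fle[of a b y] Gle[of a b y] Jle[of a b y]
      by (auto simp: H_def)
    show "H a b y \<Longrightarrow> x \<in> U \<Longrightarrow> e \<sqsubseteq> x \<Longrightarrow> H a b (x \<bullet> y)"
      using F.subid_left G.subid_left FJ[of x a b y a] by (auto simp: H_def)
    show "H a b y \<Longrightarrow> x \<in> U \<Longrightarrow> e \<sqsubseteq> x \<Longrightarrow> H a b (y \<bullet> x)"
      using F.subid_right G.subid_right JG[of a b y x b] by (auto simp: H_def)
  next
    fix a b d x y
    assume H: "H a b x" "H b d y"
    then have U: "x \<in> U" "y \<in> U" using F.mem G.mem by (auto simp: H_def J_def)
    \<comment> \<open>The position of \<open>b\<close> relative to \<open>k\<close> excludes the
      other four combinations.\<close>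
    consider "F a b x" "F b d y" | "F a b x" "G b d y" | "F a b x" "J b d y" | "G a b x" "G b d y"
      | "J a b x" "G b d y"
      using H Fle[of a b x] Gle[of a b x] Jle[of a b x] Fle[of b d y] Gle[of b d y] Jle[of b d y]
      by (auto simp: H_def)
    then show "H a d (x \<bullet> y)"
    proof cases
      case 1
      then show ?thesis using F.comp by (auto simp: H_def)
    next
      case 2
      then have "b = k" using Fle Gle by fastforce
      then have "J a d (x \<bullet> y)" using 2 U le_refl closed(5) unfolding J_def by blast
      then show ?thesis by (simp add: H_def)
    next
      case 3
      then show ?thesis using FJ[of x b d y a] F.comp U by (auto simp: H_def)
    next
      case 4
      then show ?thesis using G.comp by (auto simp: H_def)
    next
      case 5
      then show ?thesis using JG[of a b x y d] G.comp U by (auto simp: H_def)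
    qed
  qed
  moreover have "(a = i \<or> m < a \<and> a \<le> N) \<and> (b = j \<or> m < b \<and> b \<le> N)" if "H a b x" for a b x
    using that F G ord unfolding H_def J_def by fastforce
  moreover have "H i j y \<longleftrightarrow> e \<bullet> eval A val (trm_of (PComp p q)) \<sqsubseteq> y" if y: "y \<in> U" for y
  proof -
    have pF: "F i k u \<longleftrightarrow> e \<bullet> ?p \<sqsubseteq> u" if "u \<in> U" for u using p that by (auto simp: net_def)
    have qG: "G k j w \<longleftrightarrow> e \<bullet> ?q \<sqsubseteq> w" if "w \<in> U" for w using q that by (auto simp: net_def)
    \<comment> \<open>Since \<open>F i k\<close> and \<open>G k j\<close> are principal,
      \<open>J i j\<close> is generated by the product of their generators, in which the two
      occurrences of \<open>e\<close> merge.\<close>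
    have eq: "(e \<bullet> ?p) \<bullet> (e \<bullet> ?q) = e \<bullet> (?p \<bullet> ?q)" using subid_distrib[OF e] pq by simp
    have "H i j y \<longleftrightarrow> J i j y" using Fle[of i j y] Gle[of i j y] ord by (auto simp: H_def)
    also have "\<dots> \<longleftrightarrow> (e \<bullet> ?p) \<bullet> (e \<bullet> ?q) \<sqsubseteq> y"
    proof
      assume "J i j y"
      then obtain u w where *: "F i k u" "G k j w" "u \<bullet> w \<sqsubseteq> y" by (auto simp: J_def)
      then have U: "u \<in> U" "w \<in> U" using F.mem G.mem by auto
      then have "(e \<bullet> ?p) \<bullet> (e \<bullet> ?q) \<sqsubseteq> u \<bullet> w" using * pF qG pq e by (simp add: cmp_mono)
      then show "(e \<bullet> ?p) \<bullet> (e \<bullet> ?q) \<sqsubseteq> y" using * U y pq e by (meson closed(5) le_trans)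
    next
      assume "(e \<bullet> ?p) \<bullet> (e \<bullet> ?q) \<sqsubseteq> y"
      then show "J i j y" using pF qG pq e y unfolding J_def by (meson closed(5) le_refl)
    qed
    finally show ?thesis using eq by simp
  qed
  moreover have "map c [i..<j] \<in> eval full_lang (net_val c e val H) (trm_of (PComp p q))"
  proof -
    have "map c [i..<k] \<in> eval full_lang (net_val c e val H) (trm_of p)"
      by (rule eval_net_val_mono[of _ _ _ _ F]) (use p in \<open>auto simp: net_def H_def\<close>)
    moreover have "map c [k..<j] \<in> eval full_lang (net_val c e val H) (trm_of q)"
      by (rule eval_net_val_mono[of _ _ _ _ G]) (use q in \<open>auto simp: net_def H_def\<close>)
    moreover have "map c [i..<j] = map c [i..<k] @ map c [k..<j]"
      using ord upt_add_eq_append[of i k "j - k"] by simp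
    ultimately show ?thesis by (auto simp: lang_conc_def)
  qed
  ultimately have "net e val c H i j m N (PComp p q)" by (simp add: net_def)
  then show ?thesis by blast
qed

text \<open>
  Leaving the right end point \<open>j\<close> free lets the nets of the two arguments of a meet share both
  end points while their inner points lie in the disjoint intervals \<open>(m, M]\<close> and \<open>(M, N]\<close>.
\<close>

lemma ex_net: "i \<le> m \<Longrightarrow> \<exists>M\<ge>m. \<forall>j>M. \<exists>F. net e val c F i j m M p"
proof (induction p arbitrary: i m)
  case (PVar x)
  then show ?case using net_Var by (meson le_less_trans order_refl)
next
  case (PMeet p q)
  obtain M where M: "M \<ge> m" "\<forall>j>M. \<exists>F. net e val c F i j m M p" using PMeet by blast
  then have "i \<le> M" using PMeet.prems by simp
  then obtain N where N: "N \<ge> M" "\<forall>j>N. \<exists>F. net e val c F i j M N q" using PMeet by blast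
  have "\<exists>F. net e val c F i j m N (PMeet p q)" if "j > N" for j
    using M N that PMeet.prems net_Meet by (meson le_less_trans)
  then show ?case using M N by (meson order_trans)
next
  case (PComp p q)
  obtain M where M: "M \<ge> m" "\<forall>j>M. \<exists>F. net e val c F i j m M p" using PComp by blast
  \<comment> \<open>The cut point is \<open>Suc M\<close>, the first admissible right end for
    \<open>p\<close>; it is both the left end and the lower bound of inner points for
    \<open>q\<close>.\<close>
  obtain N where N: "N \<ge> Suc M" "\<forall>j>N. \<exists>F. net e val c F (Suc M) j (Suc M) N q"
    using PComp(2)[of "Suc M" "Suc M"] by blast
  have "\<exists>F. net e val c F i j m N (PComp p q)" if "j > N" for j
    using M N that PComp.prems net_Comp by (meson lessI)
  then show ?case using M N by (meson order_trans Suc_leD)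
qed

end

end

text \<open>For these terms filters do lead back to words: an element below a meet is below every
  variable in it.\<close>

lemma eps_mem_subid_trm:
  assumes "\<And>x. val x \<in> U" "e \<in> U" "e \<sqsubseteq> eval A val (subid_trm C)"
  shows "[] \<in> eval full_lang (net_val c e val F) (subid_trm C)"
  using assms(3)
proof (induction C)
  case (Cons x C)
  let ?C = "eval A val (subid_trm C)"
  have U: "val x \<in> U" "?C \<in> U" using assms ev_closed[of val] by auto
  then have "val x \<sqinter> ?C \<sqsubseteq> val x" "val x \<sqinter> ?C \<sqsubseteq> ?C" by (simp_all add: mul_le1 mul_le2)
  then have "e \<sqsubseteq> val x" "e \<sqsubseteq> ?C"
    using Cons.prems U assms(2) by (auto intro: le_trans[of e "val x \<sqinter> ?C"])
  then show ?case using Cons.IH by (simp add: net_val_def)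
qed simp

end

section \<open>From inclusions of languages to inequalities in models\<close>

lemma lang_model_full_lang: "lang_model (full_lang :: 'c list set alg)"
  using Lang_subset_models full_lang_in_Lang by (auto simp: lang_model_def)

text \<open>By soundness the normal form expansion is available for languages too, so each normal
  form of a term denotes a sublanguage of it.\<close>

interpretation L: lang_model full_lang
  by (rule lang_model_full_lang)

lemma eval_nform_subset:
  assumes "n \<in> set (nforms t)"
  shows "eval full_lang w (nform_trm n) \<subseteq> eval full_lang w t"
  using L.add_list_upper[of "map (\<lambda>n. eval full_lang w (nform_trm n)) (nforms t)"
      "eval full_lang w (nform_trm n)"] assms L.eval_nforms[of w t]
  by (auto simp: L.le_def)

text \<open>It suffices to bound each normal form of \<open>s\<close>. In its canonical model a
  suitable word belongs to the normal form, hence to \<open>s\<close> and to \<open>t\<close>, and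
  \<open>net_val_truth\<close> turns this into the inequality in \<open>A\<close>.\<close>

lemma (in lang_model) le_if_lang_le:
  fixes val :: "'v \<Rightarrow> 'a"
  assumes inf: "infinite (UNIV :: 'c set)" and val: "\<And>x. val x \<in> U"
    and le: "\<And>w :: 'v \<Rightarrow> 'c list set. eval full_lang w s \<subseteq> eval full_lang w t"
  shows "eval A val s \<sqsubseteq> eval A val t"
proof -
  obtain c :: "nat \<Rightarrow> 'c" where c: "inj c"
    using infinite_countable_subset[OF inf] by auto
  note [simp] = ev_closed[of val, OF val]
  have "eval A val (nform_trm n) \<sqsubseteq> eval A val t" if n: "n \<in> set (nforms s)" for n
  proof -
    obtain C r where nC: "n = (C, r)" by fastforce
    define e where "e = eval A val (subid_trm C)"
    have e: "e \<in> U" "e \<sqsubseteq> \<ii>" using subid_trm_le[of val, OF val] by (auto simp: e_def)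
    have eps: "[] \<in> eval full_lang (net_val c e val F) (subid_trm C)" for F
      by (rule eps_mem_subid_trm[of val, OF val e(1)]) (simp add: e_def)
    have sub: "eval full_lang w (nform_trm n) \<subseteq> eval full_lang w t" for w :: "'v \<Rightarrow> 'c list set"
      using eval_nform_subset[OF n] le by blast
    show ?thesis
    proof (cases r)
      case None
      \<comment> \<open>Without a positive factor the relevant word is \<open>[]\<close>, so a net
        without any information is enough.\<close>
      have "filter_net A e (\<lambda>_ _ _. False)" by unfold_locales auto
      from filter_net.net_val_truth[where val = val and t = t, OF this c val e]
      show ?thesis using sub eps[of "\<lambda>_ _ _. False"] None nC by (auto simp: e_def)
    next
      case (Some p)
      obtain M where "\<forall>j>M. \<exists>F. net e val c F 0 j 0 M p" using ex_net[of e val 0 0 c p, OF e val] by auto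
      then obtain F where F: "net e val c F 0 (Suc M) 0 M p" by blast
      then have fn: "filter_net A e F"
        and word: "map c [0..<Suc M] \<in> eval full_lang (net_val c e val F) (trm_of p)"
        and top: "\<And>y. y \<in> U \<Longrightarrow> F 0 (Suc M) y \<Longrightarrow> e \<bullet> eval A val (trm_of p) \<sqsubseteq> y"
        by (auto simp: net_def)
      have "map c [0..<Suc M] \<in> eval full_lang (net_val c e val F) (nform_trm n)"
        using eps[of F] word nC Some append_Nil unfolding nform_trm.simps eval.simps lang_conc_def
        by (force simp del: upt_Suc simp: lang_conc_def)
      then have "F 0 (Suc M) (eval A val t)"
        using filter_net.net_val_truth[where val = val and t = t, OF fn c val e] sub by blast
      then show ?thesis using top nC Some by (simp add: e_def)
    qed
  qed
  then show ?thesis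
    unfolding eval_nforms[of val s, OF val] by (intro add_list_least) auto
qed

section \<open>Completeness\<close>

text \<open>An infinite type absorbs its square and contains a copy of \<open>nat\<close>, so a term
  can be coded by nested pairs with a numeric tag for each constructor.\<close>

lemma inj_trm_encoding:
  fixes f :: "'a \<Rightarrow> 'i"
  assumes "infinite (UNIV :: 'i set)" "inj f"
  shows "\<exists>g :: 'a trm \<Rightarrow> 'i. inj g"
proof -
  obtain pr :: "'i \<times> 'i \<Rightarrow> 'i" where pr: "inj pr"
    using card_of_Times_same_infinite[OF assms(1)] unfolding card_of_ordIso[symmetric]
    by (auto simp: bij_betw_def)
  obtain k :: "nat \<Rightarrow> 'i" where k: "inj k"
    using infinite_countable_subset[OF assms(1)] by auto
  define g :: "'a trm \<Rightarrow> 'i" where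
    "g = rec_trm (\<lambda>x. pr (k 0, f x)) (pr (k 1, k 0)) (pr (k 2, k 0))
      (\<lambda>_ _ a b. pr (k 3, pr (a, b))) (\<lambda>_ _ a b. pr (k 4, pr (a, b))) (\<lambda>_ _ a b. pr (k 5, pr (a, b)))"
  have [simp]: "pr x = pr y \<longleftrightarrow> x = y" "k m = k n \<longleftrightarrow> m = n" "f a = f b \<longleftrightarrow> a = b" for x y m n a b
    using pr k assms(2) by (auto simp: inj_eq)
  have "g s = g t \<longrightarrow> s = t" for s t
  proof (induction s arbitrary: t)
    case (Var x)
    then show ?case by (cases t) (auto simp: g_def)
  next
    case Zero
    then show ?case by (cases t) (auto simp: g_def)
  next
    case One
    then show ?case by (cases t) (auto simp: g_def)
  next
    case (Plus s1 s2)
    then show ?case by (cases t) (auto simp: g_def)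
  next
    case (Times s1 s2)
    then show ?case by (cases t) (auto simp: g_def)
  next
    case (Comp s1 s2)
    then show ?case by (cases t) (auto simp: g_def)
  qed
  then show ?thesis by (auto simp: inj_def)
qed

lemma (in lang_model) in_generated_variety_Lang:
  assumes infc: "infinite (UNIV :: 'c set)"
    and infi: "infinite (UNIV :: 'i set)"
    and "\<exists>f :: 'a \<Rightarrow> 'i. inj f"
  shows "A \<in> generated_variety TYPE('i) (Lang :: 'c list set alg set)"
proof -
  obtain g :: "'a trm \<Rightarrow> 'i" where g: "inj g" using inj_trm_encoding infi assms(3) by blast
  \<comment> \<open>The variables are all elements of \<open>'a\<close>; those outside the carrier
    get the dummy value \<open>zero_el A\<close>.\<close>
  define val where "val x = (if x \<in> U then x else zero_el A)" for x
  have val: "val x \<in> U" for x by (simp add: val_def)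
  note [simp] = ev_closed[of val, OF val]
  have sep: "\<exists>w :: 'a \<Rightarrow> 'c list set. eval A val s \<noteq> eval A val t \<longrightarrow> eval full_lang w s \<noteq> eval full_lang w t"
    for s t
  proof (rule ccontr)
    assume "\<not> ?thesis"
    then have neq: "eval A val s \<noteq> eval A val t"
      and eq: "\<And>w :: 'a \<Rightarrow> 'c list set. eval full_lang w s = eval full_lang w t" by auto
    have "eval A val s \<sqsubseteq> eval A val t" "eval A val t \<sqsubseteq> eval A val s"
      using le_if_lang_le[where val = val, OF infc val] eq by (metis order_refl)+
    then show False using neq by (simp add: le_antisym)
  qed
  \<comment> \<open>The term \<open>s \<oplus> t\<close> serves as a code for the pair of
    \<open>s\<close> and \<open>t\<close>. The choice is arbitrary at an index that codes no pair,
    or a pair with equal values in \<open>A\<close>.\<close>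
  define w :: "'i \<Rightarrow> 'a \<Rightarrow> 'c list set" where "w i = (SOME w. \<forall>s t. i = g (s \<oplus> t) \<longrightarrow>
    eval A val s \<noteq> eval A val t \<longrightarrow> eval full_lang w s \<noteq> eval full_lang w t)" for i
  have w: "eval full_lang (w (g (s \<oplus> t))) s \<noteq> eval full_lang (w (g (s \<oplus> t))) t"
    if neq: "eval A val s \<noteq> eval A val t" for s t
  proof -
    obtain u :: "'a \<Rightarrow> 'c list set" where "eval full_lang u s \<noteq> eval full_lang u t"
      using sep[of s t] neq by auto
    then have "\<exists>w :: 'a \<Rightarrow> 'c list set. \<forall>s' t'. g (s \<oplus> t) = g (s' \<oplus> t') \<longrightarrow>
        eval A val s' \<noteq> eval A val t' \<longrightarrow> eval full_lang w s' \<noteq> eval full_lang w t'"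
      using g by (intro exI[of _ u]) (auto simp: inj_eq)
    from someI_ex[OF this] show ?thesis using neq unfolding w_def by blast
  qed
  define P :: "('i \<Rightarrow> 'c list set) alg" where "P = product_alg UNIV (\<lambda>_. full_lang)"
  define v :: "'a \<Rightarrow> 'i \<Rightarrow> 'c list set" where "v x = (\<lambda>i. w i x)" for x
  have ev: "eval P v t i = eval full_lang (w i) t" for t i
    by (simp add: P_def eval_product v_def)
  have wd: "eval A val s = eval A val t" if "eval P v s = eval P v t" for s t
    using w[of s t] that ev by metis
  \<comment> \<open>The subalgebra of the power generated by the tuples \<open>v x\<close>. By
    \<open>wd\<close>, equal tuples come from terms with equal values in \<open>A\<close>.\<close>
  define B where "B = P\<lparr>carrier := range (eval P v)\<rparr>"
  have B_simps: "carrier B = range (eval P v)" "plus_op B = plus_op P" "times_op B = times_op P"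
    "comp_op B = comp_op P" "zero_el B = zero_el P" "one_el B = one_el P"
    by (simp_all add: B_def)
  have P_in: "P \<in> \<P> (Lang :: 'c list set alg set)"
    unfolding \<P>_def P_def using full_lang_in_Lang by blast
  have fold: "zero_el P = eval P v \<zero>" "one_el P = eval P v \<one>"
    "\<And>s t. plus_op P (eval P v s) (eval P v t) = eval P v (s \<oplus> t)"
    "\<And>s t. times_op P (eval P v s) (eval P v t) = eval P v (s \<odot> t)"
    "\<And>s t. comp_op P (eval P v s) (eval P v t) = eval P v (s \<otimes> t)" by simp_all
  have algB: "algebra B"
    unfolding algebra_def B_simps by (auto simp: fold simp del: eval.simps)
  have "subalgebra B P"
    unfolding subalgebra_def using algB by (auto simp: B_simps) (simp add: P_def product_alg_def)
  then have B_in: "B \<in> \<S> (\<P> (Lang :: 'c list set alg set))"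
    using P_in by (auto simp: \<S>_def)
  \<comment> \<open>Any term representing \<open>b\<close> may be chosen, since \<open>wd\<close>
    makes the value independent of the choice.\<close>
  define h where "h b = eval A val (SOME t. eval P v t = b)" for b
  have h: "h (eval P v t) = eval A val t" for t
    unfolding h_def by (rule wd) (rule someI[of _ t], rule refl)
  have "homomorphism h B A"
    unfolding homomorphism_def B_simps
    by (auto simp: fold h simp del: eval.simps) simp_all
  moreover have "h ` carrier B = carrier A"
  proof
    show "h ` carrier B \<subseteq> carrier A" by (auto simp: B_simps h)
    show "carrier A \<subseteq> h ` carrier B"
    proof
      fix a assume "a \<in> carrier A"
      then have "a = h (eval P v (Var a))" by (simp only: h) (simp add: val_def)
      then show "a \<in> h ` carrier B" by (auto simp: B_simps simp del: eval.simps)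
    qed
  qed
  ultimately show ?thesis
    using B_in alg unfolding generated_variety_def \<H>_def by blast
qed

theorem theorem2p3:
  assumes "infinite (UNIV :: 'c set)"
    and "infinite (UNIV :: 'i set)"
    and "\<exists>e :: 'a \<Rightarrow> 'i. inj e"
  shows "generated_variety TYPE('i) (Lang :: 'c list set alg set) =
    (models ({(X \<otimes> Y) \<odot> \<one> \<doteq> (X \<odot> \<one>) \<otimes> (Y \<odot> \<one>)} \<union> Ax\<^sub>i) :: 'a alg set)"
  using generated_variety_subset_models[OF Lang_subset_models]
    lang_model.in_generated_variety_Lang[OF lang_model.intro assms] by (intro antisym subsetI) auto

end
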